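(* Let $\{S_i\}_{i=1}^m$ be an SS-IFS in $\mathbb{R}^d$ with attractor $K$ containing at least two points and transformation group $\mathcal{T}$, and let $t=\dim_H(K)$. Let $O\in\overline{\mathcal{T}}$ be arbitrary and $\delta>0$. Then there exists $\mathcal{I}_\infty\subseteq\bigcup_{k=1}^\infty\mathcal{I}^k$ such that $\|T_{\mathbf{i}}-O\|<\delta$ for all $\mathbf{i}\in\mathcal{I}_\infty$, $K_{\mathbf{i}}\cap K_{\mathbf{j}}=\emptyset$ for all $\mathbf{i},\mathbf{j}\in\mathcal{I}_\infty$ with $\mathbf{i}\neq\mathbf{j}$, and $\mathcal{H}^t\left(K\setminus\bigcup_{\mathbf{i}\in\mathcal{I}_\infty}K_{\mathbf{i}}\right)=0$.
   Context: $\dim_H$ denotes Hausdorff dimension, $\mathcal{H}^t$ denotes $t$-dimensional Hausdorff measure, and $\|\cdot\|$ is the Euclidean operator norm, which metrizes the compact group $\mathbb{O}_d$ of orthogonal transformations of $\mathbb{R}^d$. A self-similar iterated function system (SS-IFS) in $\mathbb{R}^d$ is a finite collection $\{S_i\}_{i=1}^m$ of contracting similarities of $\mathbb{R}^d$, written uniquely as $S_i(x)=r_iT_i(x)+v_i$ with $0<r_i<1$, $T_i\in\mathbb{O}_d$ and $v_i\in\mathbb{R}^d$. Its attractor is the unique nonempty compact $K$ with $K=\bigcup_{i=1}^m S_i(K)$. Its transformation group $\mathcal{T}$ is the group generated by $T_1,\ldots,T_m$, and $\overline{\mathcal{T}}$ is its closure in $\mathbb{O}_d$. $\mathcal{I}=\{1,\ldots,m\}$;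 for $\mathbf{i}=(i_1,\ldots,i_k)\in\mathcal{I}^k$ write $S_{\mathbf{i}}=S_{i_1}\circ\cdots\circ S_{i_k}$, $T_{\mathbf{i}}=T_{i_1}\circ\cdots\circ T_{i_k}$ and $K_{\mathbf{i}}=S_{\mathbf{i}}(K)$. No separation condition is assumed. *)

theory Defs
  imports "HOL-Analysis.Analysis" "HOL-Algebra.Generated_Groups"
begin

section \<open>Hausdorff measure and dimension\<close>

text \<open>
  The term $\mathrm{diam}(U)^s$ in the definition of Hausdorff measure, with the usual conventions
  that the empty set contributes 0 and that $0^0 = 1$ (whereas \<open>0 powr 0 = 0\<close>).
\<close>
definition diam_powr :: "real \<Rightarrow> 'a::metric_space set \<Rightarrow> ennreal" where
  "diam_powr s U = (if U = {} then 0 else if s = 0 then 1 else ennreal (diameter U powr s))"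

text \<open>
  Boundedness of the covering sets is explicit because \<^const>\<open>diameter\<close> is meaningless
  on unbounded sets. Finite covers are included, since sets may be empty.
\<close>
definition delta_covers :: "real \<Rightarrow> 'a::metric_space set \<Rightarrow> (nat \<Rightarrow> 'a set) set" where
  "delta_covers \<delta> A =
     {U. A \<subseteq> (\<Union>n. U n) \<and> (\<forall>n. bounded (U n) \<and> diameter (U n) \<le> \<delta>)}"

definition hausdorff_premeasure :: "real \<Rightarrow> real \<Rightarrow> 'a::metric_space set \<Rightarrow> ennreal" where
  "hausdorff_premeasure s \<delta> A = (INF U \<in> delta_covers \<delta> A. \<Sum>n. diam_powr s (U n))"

text \<open>
  The \<open>s\<close>-dimensional Hausdorff (outer) measure, without a normalising constant. The supremum is
  the limit as \<open>\<delta>\<close> tends to 0, the premeasure being antitone in \<open>\<delta>\<close>.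
\<close>
definition hausdorff_measure :: "real \<Rightarrow> 'a::metric_space set \<Rightarrow> ennreal" where
  "hausdorff_measure s A = (SUP \<delta> \<in> {0<..}. hausdorff_premeasure s \<delta> A)"

text \<open>
  A real number, since in a Euclidean space all \<open>s > DIM('a)\<close> belong to the set on the right.
\<close>
definition hausdorff_dim :: "'a::euclidean_space set \<Rightarrow> real" where
  "hausdorff_dim A = Inf {s. 0 \<le> s \<and> hausdorff_measure s A = 0}"


section \<open>The orthogonal group\<close>

text \<open>
  Orthogonal maps are elements of the type of bounded linear maps, whose \<^const>\<open>norm\<close>
  is the operator norm. The orthogonal maps form a closed subset of that type, so the closure of a
  set of orthogonal maps may be taken there.
\<close>
definition orthogonal_group :: "('a::euclidean_space \<Rightarrow>\<^sub>L 'a) monoid" where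
  "orthogonal_group =
     \<lparr>carrier = {f. orthogonal_transformation (blinfun_apply f)},
      monoid.mult = (o\<^sub>L), one = id_blinfun\<rparr>"

lemma group_orthogonal_group: "group (orthogonal_group :: ('a::euclidean_space \<Rightarrow>\<^sub>L 'a) monoid)"
proof (rule groupI)
  fix f :: "'a \<Rightarrow>\<^sub>L 'a"
  assume "f \<in> carrier orthogonal_group"
  then have f: "orthogonal_transformation (blinfun_apply f)"
    by (simp add: orthogonal_group_def)
  let ?g = "Blinfun (inv_into UNIV (blinfun_apply f))"
  have o: "orthogonal_transformation (inv_into UNIV (blinfun_apply f))"
    using f by (rule orthogonal_transformation_inv)
  then have "bounded_linear (inv_into UNIV (blinfun_apply f))"
    by (auto simp: orthogonal_transformation_def linear_linear)
  then have g: "blinfun_apply ?g = inv_into UNIV (blinfun_apply f)"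
    by (rule bounded_linear_Blinfun_apply)
  have "?g o\<^sub>L f = id_blinfun"
    by (rule blinfun_eqI) (simp add: g orthogonal_transformation_inj[OF f])
  with o g show "\<exists>g\<in>carrier orthogonal_group. g \<otimes>\<^bsub>orthogonal_group\<^esub> f = \<one>\<^bsub>orthogonal_group\<^esub>"
    by (intro bexI[of _ ?g]) (simp_all add: orthogonal_group_def)
qed (auto simp: orthogonal_group_def orthogonal_transformation_def
       intro!: blinfun_eqI bounded_linear.linear blinfun.bounded_linear_right bounded_linear_ident)


section \<open>Self-similar iterated function systems\<close>

definition ss_ifs ::
  "nat \<Rightarrow> (nat \<Rightarrow> 'a \<Rightarrow> 'a) \<Rightarrow> (nat \<Rightarrow> real) \<Rightarrow> (nat \<Rightarrow> 'a \<Rightarrow>\<^sub>L 'a) \<Rightarrow> (nat \<Rightarrow> 'a::euclidean_space) \<Rightarrow> bool"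
where
  "ss_ifs m S r T v \<longleftrightarrow>
     (\<forall>i\<in>{1..m}. 0 < r i \<and> r i < 1 \<and> T i \<in> carrier orthogonal_group \<and>
        (\<forall>x. S i x = r i *\<^sub>R blinfun_apply (T i) x + v i))"

definition is_attractor :: "nat \<Rightarrow> (nat \<Rightarrow> 'a \<Rightarrow> 'a) \<Rightarrow> 'a::euclidean_space set \<Rightarrow> bool" where
  "is_attractor m S K \<longleftrightarrow> K \<noteq> {} \<and> compact K \<and> K = (\<Union>i\<in>{1..m}. S i ` K)"

definition transformation_group ::
  "nat \<Rightarrow> (nat \<Rightarrow> 'a \<Rightarrow>\<^sub>L 'a) \<Rightarrow> ('a::euclidean_space \<Rightarrow>\<^sub>L 'a) set" where
  "transformation_group m T = generate orthogonal_group (T ` {1..m})"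

definition ifs_words :: "nat \<Rightarrow> nat list set" where
  "ifs_words m = (\<Union>k\<in>{1..}. {w. length w = k \<and> set w \<subseteq> {1..m}})"

definition word_map :: "(nat \<Rightarrow> 'a \<Rightarrow> 'a) \<Rightarrow> nat list \<Rightarrow> 'a \<Rightarrow> 'a" where
  "word_map S w = foldr (\<circ>) (map S w) id"

definition word_orth :: "(nat \<Rightarrow> 'a \<Rightarrow>\<^sub>L 'a) \<Rightarrow> nat list \<Rightarrow> 'a::euclidean_space \<Rightarrow>\<^sub>L 'a" where
  "word_orth T w = foldr (o\<^sub>L) (map T w) id_blinfun"

end

theory Submission
  imports Defs
begin

text \<open>
  If \<open>J\<close> is a finite set of words with pairwise disjoint cylinders, the contraction ratios satisfy
  $\sum_{j \in J} r_j^t \le 1$: otherwise $\sum_{j \in J} r_j^s \ge 1$ for some \<open>s > t\<close>, and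
  the strong separation of the cylinders gives \<open>K\<close> positive \<open>s\<close>-dimensional measure. By
  compactness of the orthogonal group, every word \<open>j\<close> has an extension \<open>jw\<close> whose orthogonal part
  is \<open>\<delta>\<close>-close to \<open>Q\<close>, with the ratio of \<open>w\<close> bounded below independently of \<open>j\<close>. Among all words
  with orthogonal part close to \<open>Q\<close>, select a disjoint family \<open>W\<close> greedily by decreasing ratio. As in
  Vitali's covering theorem, whatever \<open>W\<close> fails to cover lies, for each finite \<open>F \<subseteq> W\<close>, in the
  union of balls of radius comparable to $r_w$ for \<open>w \<in> W - F\<close>. Their \<open>t\<close>-sums are tails of
  the convergent series $\sum_{w \in W} r_w^t$.
\<close>

section \<open>Hausdorff measure\<close>

lemma diam_powr_le:
  assumes "diameter U \<le> b" "0 < b" "0 \<le> s" "bounded U"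
  shows "diam_powr s U \<le> ennreal (b powr s)"
  using assms diameter_ge_0[of U] by (auto simp: diam_powr_def intro!: ennreal_leI powr_mono2)

text \<open>The balls are indexed by a subset of any countable type, such as words, and the
  hypothesis bounds finite partial sums, so applications never handle infinite series.\<close>

lemma hausdorff_measure_eq_0I:
  fixes A :: "'a::real_normed_vector set"
  assumes "0 \<le> s"
    and small: "\<And>\<eta> \<epsilon>. 0 < \<eta> \<Longrightarrow> 0 < \<epsilon> \<Longrightarrow> \<exists>(I::'i::countable set) z b.
      A \<subseteq> (\<Union>i\<in>I. cball (z i) (b i)) \<and> (\<forall>i\<in>I. 0 < b i \<and> 2 * b i \<le> \<eta>) \<and>
      (\<forall>G. finite G \<longrightarrow> G \<subseteq> I \<longrightarrow> (\<Sum>i\<in>G. (2 * b i) powr s) \<le> \<epsilon>)"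
  shows "hausdorff_measure s A = 0"
proof -
  have bound: "hausdorff_premeasure s \<eta> A \<le> 0 + ennreal \<epsilon>" if "0 < \<eta>" "0 < \<epsilon>" for \<eta> \<epsilon>
  proof -
    from small[OF that] obtain I :: "'i set" and z b where
      I: "A \<subseteq> (\<Union>i\<in>I. cball (z i) (b i)) \<and> (\<forall>i\<in>I. 0 < b i \<and> 2 * b i \<le> \<eta>) \<and>
        (\<forall>G. finite G \<longrightarrow> G \<subseteq> I \<longrightarrow> (\<Sum>i\<in>G. (2 * b i) powr s) \<le> \<epsilon>)"
      by (elim exE)
    then have cov: "A \<subseteq> (\<Union>i\<in>I. cball (z i) (b i))"
      and b: "\<And>i. i \<in> I \<Longrightarrow> 0 < b i" "\<And>i. i \<in> I \<Longrightarrow> 2 * b i \<le> \<eta>"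
      and sum: "\<And>G. finite G \<Longrightarrow> G \<subseteq> I \<Longrightarrow> (\<Sum>i\<in>G. (2 * b i) powr s) \<le> \<epsilon>"
      by simp_all
    \<comment> \<open>Numbers that encode no index get the empty set, which contributes 0 even for
      \<open>s = 0\<close>.\<close>
    define U where "U n = (if n \<in> to_nat ` I then cball (z (from_nat n)) (b (from_nat n)) else {})" for n
    have U_to_nat: "U (to_nat i) = cball (z i) (b i)" if "i \<in> I" for i
      using that by (simp add: U_def)
    have diam: "diameter (cball (z i) (b i)) \<le> 2 * b i" if "i \<in> I" for i
    proof (rule diameter_le)
      fix x y assume "x \<in> cball (z i) (b i)" "y \<in> cball (z i) (b i)"
      then show "norm (x - y) \<le> 2 * b i"
        using dist_triangle3[of x y "z i"] by (auto simp: dist_norm)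
    qed (use b(1)[OF that] in auto)
    have in_covers: "U \<in> delta_covers \<eta> A"
      unfolding delta_covers_def
    proof (intro CollectI conjI allI)
      show "A \<subseteq> (\<Union>n. U n)"
      proof
        fix x assume "x \<in> A"
        with cov obtain i where "i \<in> I" "x \<in> cball (z i) (b i)" by auto
        then show "x \<in> (\<Union>n. U n)"
          by (intro UN_I[of "to_nat i"]) (simp_all add: U_to_nat)
      qed
      fix n
      show "bounded (U n)" by (simp add: U_def)
      show "diameter (U n) \<le> \<eta>"
      proof (cases "n \<in> to_nat ` I")
        case True
        then obtain i where "i \<in> I" "n = to_nat i" by auto
        with U_to_nat[of i] diam[of i] b(2)[of i] show ?thesis by simp
      qed (use that in \<open>simp add: U_def\<close>)
    qed
    have "(\<Sum>n<N. diam_powr s (U n)) \<le> ennreal \<epsilon>" for N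
    proof -
      define G where "G = {i\<in>I. to_nat i < N}"
      have finG: "finite G"
      proof (rule inj_on_finite[of to_nat])
        show "to_nat ` G \<subseteq> {..<N}" by (auto simp: G_def)
      qed auto
      have "(\<Sum>n<N. diam_powr s (U n)) = (\<Sum>n\<in>to_nat ` G. diam_powr s (U n))"
        by (rule sum.mono_neutral_right) (auto simp: G_def U_def diam_powr_def)
      also have "\<dots> = (\<Sum>i\<in>G. diam_powr s (cball (z i) (b i)))"
        by (subst sum.reindex) (auto simp: G_def U_to_nat intro!: sum.cong)
      also have "\<dots> \<le> (\<Sum>i\<in>G. ennreal ((2 * b i) powr s))"
        using b diam \<open>0 \<le> s\<close> by (intro sum_mono diam_powr_le) (auto simp: G_def)
      also have "\<dots> = ennreal (\<Sum>i\<in>G. (2 * b i) powr s)"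
        by (simp add: sum_ennreal)
      also have "\<dots> \<le> ennreal \<epsilon>"
        by (intro ennreal_leI sum finG) (auto simp: G_def)
      finally show ?thesis .
    qed
    then have "(\<Sum>n. diam_powr s (U n)) \<le> ennreal \<epsilon>"
      by (intro suminf_le_const) auto
    then show ?thesis
      unfolding hausdorff_premeasure_def using INF_lower2[OF in_covers] by simp
  qed
  have "hausdorff_premeasure s \<eta> A \<le> 0" if "0 < \<eta>" for \<eta>
    by (rule ennreal_le_epsilon) (rule bound[OF that])
  then show ?thesis
    by (auto simp: hausdorff_measure_def)
qed

text \<open>Prepares covers for a compactness argument. Points in the union of the
  \<open>h\<close>-balls around points of \<open>U\<close> are at most
  \<open>diameter U + 2 * h\<close> apart, and the \<open>s\<close>-th power of this is
  right-continuous at \<open>h = 0\<close>. The empty set gets an empty \<open>V\<close> and a small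
  positive \<open>b\<close>.\<close>

lemma open_enlargement:
  fixes U :: "'a::metric_space set"
  assumes "bounded U" "0 < s" "0 < (e::real)"
  shows "\<exists>V b. open V \<and> U \<subseteq> V \<and> 0 < b \<and> (\<forall>x\<in>V. \<forall>y\<in>V. dist x y \<le> b) \<and>
           ennreal (b powr s) \<le> diam_powr s U + ennreal e"
proof (cases "U = {}")
  case True
  have "((\<lambda>b. b powr s) \<longlongrightarrow> 0 powr s) (at_right 0)"
    using \<open>0 < s\<close> by (intro tendsto_intros) (auto intro: eventually_mono[OF eventually_at_right_less])
  then have "\<forall>\<^sub>F b in at_right 0. b powr s < e"
    using \<open>0 < e\<close> by (intro order_tendstoD) auto
  then have "\<forall>\<^sub>F b in at_right (0::real). b powr s < e \<and> 0 < b"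
    by (intro eventually_conj eventually_at_right_less)
  then obtain b :: real where "b powr s < e" "0 < b"
    using eventually_happens'[OF trivial_limit_at_right_real] by blast
  with True show ?thesis
    by (intro exI[of _ "{}"] exI[of _ b]) (auto simp: ennreal_leI add_increasing)
next
  case False
  define D where "D = diameter U"
  have "0 \<le> D" using diameter_ge_0[OF \<open>bounded U\<close>] by (simp add: D_def)
  have "((\<lambda>h. (D + 2 * h) powr s) \<longlongrightarrow> (D + 2 * 0) powr s) (at_right 0)"
    using \<open>0 < s\<close> \<open>0 \<le> D\<close>
    by (intro tendsto_intros) (auto intro: eventually_mono[OF eventually_at_right_less])
  then have "\<forall>\<^sub>F h in at_right 0. (D + 2 * h) powr s < D powr s + e"
    using \<open>0 < e\<close> by (intro order_tendstoD) auto
  then have "\<forall>\<^sub>F h in at_right (0::real). (D + 2 * h) powr s < D powr s + e \<and> 0 < h"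
    by (intro eventually_conj eventually_at_right_less)
  then obtain h :: real where h: "(D + 2 * h) powr s < D powr s + e" "0 < h"
    using eventually_happens'[OF trivial_limit_at_right_real] by blast
  have "dist x y \<le> D + 2 * h" if "a \<in> U" "b \<in> U" "x \<in> ball a h" "y \<in> ball b h" for a b x y
  proof -
    have "dist a b \<le> D"
      using diameter_bounded_bound[OF \<open>bounded U\<close>] that by (simp add: D_def)
    moreover have "dist x y \<le> dist x a + dist a b + dist b y"
      using dist_triangle[of x y a] dist_triangle[of a y b] by linarith
    ultimately show ?thesis using that by (auto simp: dist_commute)
  qed
  moreover have "ennreal ((D + 2 * h) powr s) \<le> diam_powr s U + ennreal e"
    using h False \<open>0 < s\<close> \<open>0 < e\<close>
    by (simp add: diam_powr_def D_def[symmetric] ennreal_plus[symmetric] ennreal_leI del: ennreal_plus)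
  ultimately show ?thesis
    using h \<open>0 \<le> D\<close>
    by (intro exI[of _ "\<Union>a\<in>U. ball a h"] exI[of _ "D + 2 * h"]) auto
qed

text \<open>After enlargement to open sets, compactness turns a countable cover into a finite one.
  Bounds \<open>b i\<close> on pairwise distances stand in for diameters.\<close>

lemma hausdorff_premeasure_ge:
  fixes A :: "'a::metric_space set"
  assumes "compact A" "0 < s"
    and lower: "\<And>(I::nat set) U b. finite I \<Longrightarrow> A \<subseteq> (\<Union>i\<in>I. U i) \<Longrightarrow>
      (\<And>i. i \<in> I \<Longrightarrow> 0 < b i \<and> (\<forall>x\<in>U i. \<forall>y\<in>U i. dist x y \<le> b i)) \<Longrightarrow>
      c \<le> (\<Sum>i\<in>I. b i powr s)"
  shows "ennreal c \<le> hausdorff_premeasure s \<eta> A"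
proof -
  have bound: "ennreal c \<le> (\<Sum>n. diam_powr s (U n)) + ennreal e"
    if U: "U \<in> delta_covers \<eta> A" and "0 < e" for U e
  proof -
    \<comment> \<open>The enlargement errors \<open>e * (1/2) ^ Suc n\<close> sum to
      \<open>e\<close>.\<close>
    have "\<exists>V b. open V \<and> U n \<subseteq> V \<and> 0 < b \<and> (\<forall>x\<in>V. \<forall>y\<in>V. dist x y \<le> b) \<and>
           ennreal (b powr s) \<le> diam_powr s (U n) + ennreal (e * (1/2) ^ Suc n)" for n
      using U \<open>0 < e\<close> \<open>0 < s\<close> by (intro open_enlargement) (auto simp: delta_covers_def)
    then obtain V b where "\<forall>n. open (V n) \<and> U n \<subseteq> V n \<and> 0 < b n \<and>
        (\<forall>x\<in>V n. \<forall>y\<in>V n. dist x y \<le> b n) \<and>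
        ennreal (b n powr s) \<le> diam_powr s (U n) + ennreal (e * (1/2) ^ Suc n)"
      by metis
    then have V: "\<And>n. open (V n)" "\<And>n. U n \<subseteq> V n" "\<And>n. 0 < b n"
      "\<And>n x y. x \<in> V n \<Longrightarrow> y \<in> V n \<Longrightarrow> dist x y \<le> b n"
      "\<And>n. ennreal (b n powr s) \<le> diam_powr s (U n) + ennreal (e * (1/2) ^ Suc n)"
      by simp_all
    have "A \<subseteq> (\<Union>n. U n)"
      using U by (simp add: delta_covers_def)
    also have "\<dots> \<subseteq> (\<Union>n\<in>UNIV. V n)"
      by (intro UN_mono V(2) order_refl)
    finally have "A \<subseteq> (\<Union>n\<in>UNIV. V n)" .
    with \<open>compact A\<close> V(1) obtain I where I: "finite I" "A \<subseteq> (\<Union>n\<in>I. V n)"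
      by (rule compactE_image)
    have "c \<le> (\<Sum>i\<in>I. b i powr s)"
      using V I by (intro lower[of I V]) auto
    then have "ennreal c \<le> ennreal (\<Sum>i\<in>I. b i powr s)"
      by (rule ennreal_leI)
    also have "\<dots> = (\<Sum>i\<in>I. ennreal (b i powr s))"
      by (simp add: sum_ennreal)
    also have "\<dots> \<le> (\<Sum>i\<in>I. diam_powr s (U i) + ennreal (e * (1/2) ^ Suc i))"
      by (intro sum_mono V)
    also have "\<dots> \<le> (\<Sum>i. diam_powr s (U i) + ennreal (e * (1/2) ^ Suc i))"
      by (rule sum_le_suminf) (auto simp: I)
    also have "\<dots> = (\<Sum>i. diam_powr s (U i)) + (\<Sum>i. ennreal (e * (1/2) ^ Suc i))"
      by (rule suminf_add[symmetric]) auto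
    also have "(\<Sum>i. ennreal (e * (1/2) ^ Suc i)) = ennreal e"
      using sums_mult[OF power_half_series, of e] \<open>0 < e\<close>
      by (intro suminf_ennreal_eq) auto
    finally show ?thesis .
  qed
  have "ennreal c \<le> (\<Sum>n. diam_powr s (U n))" if "U \<in> delta_covers \<eta> A" for U
    by (rule ennreal_le_epsilon) (rule bound[OF that])
  then show ?thesis
    unfolding hausdorff_premeasure_def by (rule INF_greatest)
qed

text \<open>In covers of mesh 1 every diameter is at most 1, so raising the exponent lowers every
  term. For this reason \<open>le_hausdorff_dim\<close> works at mesh 1.\<close>

lemma hausdorff_premeasure_antimono:
  fixes A :: "'a::metric_space set"
  assumes "0 \<le> u" "u \<le> s"
  shows "hausdorff_premeasure s 1 A \<le> hausdorff_premeasure u 1 A"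
  unfolding hausdorff_premeasure_def
proof (rule INF_mono)
  fix U assume U: "U \<in> delta_covers 1 A"
  have "diam_powr s (U n) \<le> diam_powr u (U n)" for n
  proof -
    have d: "0 \<le> diameter (U n)" "diameter (U n) \<le> 1"
      using U by (auto simp: delta_covers_def intro: diameter_ge_0)
    show ?thesis
    proof (cases "diameter (U n) = 0")
      case False
      with d have "diameter (U n) powr s \<le> diameter (U n) powr u"
        using assms by (intro powr_mono') auto
      moreover have "diameter (U n) powr s \<le> 1"
        using d assms by (intro powr_le1) auto
      ultimately show ?thesis
        using assms False by (auto simp: diam_powr_def intro: ennreal_leI)
    qed (use assms in \<open>auto simp: diam_powr_def\<close>)
  qed
  then show "\<exists>U'\<in>delta_covers 1 A. (\<Sum>n. diam_powr s (U' n)) \<le> (\<Sum>n. diam_powr u (U n))"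
    using U by (intro bexI[OF _ U] suminf_le) auto
qed

section \<open>Vitali selection\<close>

text \<open>A member is kept iff it meets no kept member preceding it in the order of decreasing
  \<open>f\<close>, ties being broken by \<open>to_nat\<close>. A rejected member thus meets a kept
  one with no smaller \<open>f\<close>. The finiteness assumption makes the order well-founded,
  which justifies the recursion.\<close>

lemma greedy_subfamily:
  fixes f :: "'i::countable \<Rightarrow> real"
  assumes fin: "\<And>w. w \<in> V \<Longrightarrow> finite {u\<in>V. f w \<le> f u}"
    and sym: "\<And>u w. meets u w \<Longrightarrow> meets w u"
  shows "\<exists>W\<subseteq>V. (\<forall>u\<in>W. \<forall>w\<in>W. u \<noteq> w \<longrightarrow> \<not> meets u w) \<and>
    (\<forall>w\<in>V. \<exists>u\<in>W. (u = w \<or> meets u w) \<and> f w \<le> f u)"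
proof -
  define R where "R = {(u, w). u \<in> V \<and> w \<in> V \<and> (f w < f u \<or> f u = f w \<and> to_nat u < to_nat w)}"
  \<comment> \<open>Every member has finitely many predecessors, and a predecessor \<open>u\<close>
    of \<open>w\<close> has fewer of them, since \<open>u\<close> itself drops out.\<close>
  have "R \<subseteq> Wellfounded.measure (\<lambda>w. card {u. (u, w) \<in> R})"
  proof clarify
    fix u w assume uw: "(u, w) \<in> R"
    have "finite {u. (u, w) \<in> R}"
      by (rule finite_subset[OF _ fin[of w]]) (use uw in \<open>auto simp: R_def\<close>)
    moreover have "{x. (x, u) \<in> R} \<subset> {x. (x, w) \<in> R}"
      using uw by (auto simp: R_def)
    ultimately show "(u, w) \<in> Wellfounded.measure (\<lambda>w. card {u. (u, w) \<in> R})"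
      by (simp add: psubset_card_mono)
  qed
  then have "wf R"
    using wf_measure wf_subset by blast
  \<comment> \<open>Recursion along \<open>R\<close>: \<open>P w\<close> depends only on the values
    of \<open>P\<close> at predecessors of \<open>w\<close>.\<close>
  then have "\<exists>P. \<forall>w. P w \<longleftrightarrow> w \<in> V \<and> (\<forall>u. (u, w) \<in> R \<longrightarrow> P u \<longrightarrow> \<not> meets u w)"
    by (rule dependent_wf_choice) auto
  then obtain P where P: "\<And>w. P w \<longleftrightarrow> w \<in> V \<and> (\<forall>u. (u, w) \<in> R \<longrightarrow> P u \<longrightarrow> \<not> meets u w)"
    by metis
  have "\<not> meets u w" if "P u" "P w" "u \<noteq> w" for u w
  proof -
    have "u \<in> V" "w \<in> V" using that P by blast+
    moreover have "to_nat u < to_nat w \<or> to_nat w < to_nat u"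
      using that(3) by (auto simp: neq_iff[symmetric])
    ultimately have "(u, w) \<in> R \<or> (w, u) \<in> R"
      by (auto simp: R_def)
    with that P sym show ?thesis by blast
  qed
  moreover have "\<exists>u. P u \<and> (u = w \<or> meets u w) \<and> f w \<le> f u" if "w \<in> V" for w
  proof (cases "P w")
    case False
    with P[of w] that obtain u where "(u, w) \<in> R" "P u" "meets u w" by blast
    then show ?thesis by (intro exI[of _ u]) (auto simp: R_def)
  qed auto
  moreover have "{w. P w} \<subseteq> V"
    using P by blast
  ultimately show ?thesis
    by (intro exI[of _ "{w. P w}"]) simp
qed

text \<open>Take \<open>F\<close> with sum within \<open>\<epsilon>\<close> of the supremum of all
  finite sums; a \<open>G\<close> disjoint from \<open>F\<close> with sum above
  \<open>\<epsilon>\<close> would push \<open>F \<union> G\<close> past that supremum.\<close>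

lemma finite_subset_small_tail:
  fixes f :: "'i \<Rightarrow> real"
  assumes bd: "\<And>G. finite G \<Longrightarrow> G \<subseteq> W \<Longrightarrow> sum f G \<le> B" and "0 < \<epsilon>"
  shows "\<exists>F. finite F \<and> F \<subseteq> W \<and> (\<forall>G. finite G \<longrightarrow> G \<subseteq> W - F \<longrightarrow> sum f G \<le> \<epsilon>)"
proof -
  define X where "X = sum f ` {G. finite G \<and> G \<subseteq> W}"
  have X: "X \<noteq> {}" "bdd_above X"
    using bd by (auto simp: X_def intro!: bdd_aboveI2)
  then obtain F where F: "finite F" "F \<subseteq> W" "Sup X - \<epsilon> < sum f F"
    using less_cSupD[of X "Sup X - \<epsilon>"] \<open>0 < \<epsilon>\<close> by (auto simp: X_def)
  have "sum f G \<le> \<epsilon>" if "finite G" "G \<subseteq> W - F" for G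
  proof -
    have "sum f (F \<union> G) \<in> X"
      using F that by (auto simp: X_def intro!: imageI)
    then have "sum f (F \<union> G) \<le> Sup X"
      using X by (intro cSup_upper)
    moreover have "sum f (F \<union> G) = sum f F + sum f G"
      using F that by (intro sum.union_disjoint) auto
    ultimately show ?thesis using F by simp
  qed
  with F show ?thesis by blast
qed


section \<open>Self-similar sets\<close>

lemma word_map_Nil [simp]: "word_map S [] = id"
  by (simp add: word_map_def)

lemma word_map_Cons: "word_map S (i # w) x = S i (word_map S w x)"
  by (simp add: word_map_def)

lemma word_map_append: "word_map S (u @ w) x = word_map S u (word_map S w x)"
  by (induction u) (simp_all add: word_map_Cons)

lemma word_orth_Nil [simp]: "word_orth T [] = id_blinfun"
  by (simp add: word_orth_def)

lemma word_orth_Cons: "word_orth T (i # w) = T i o\<^sub>L word_orth T w"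
  by (simp add: word_orth_def)

lemma word_orth_append: "word_orth T (u @ w) = word_orth T u o\<^sub>L word_orth T w"
  by (induction u) (auto simp: word_orth_Cons intro!: blinfun_eqI)

lemma in_ifs_words: "w \<in> ifs_words m \<longleftrightarrow> w \<noteq> [] \<and> set w \<subseteq> {1..m}"
  by (cases w) (auto simp: ifs_words_def)

locale self_similar_set =
  fixes m :: nat
    and S :: "nat \<Rightarrow> 'a::euclidean_space \<Rightarrow> 'a"
    and r :: "nat \<Rightarrow> real"
    and T :: "nat \<Rightarrow> 'a \<Rightarrow>\<^sub>L 'a"
    and v :: "nat \<Rightarrow> 'a"
    and K :: "'a set"
  assumes ifs: "ss_ifs m S r T v"
    and attractor: "is_attractor m S K"
begin

section \<open>Contraction ratios of words\<close>

definition ratio :: "nat list \<Rightarrow> real" where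
  "ratio w = prod_list (map r w)"

lemma ratio_Nil [simp]: "ratio [] = 1"
  by (simp add: ratio_def)

lemma ratio_append: "ratio (u @ w) = ratio u * ratio w"
  by (simp add: ratio_def)

lemma ratio_Cons: "ratio (i # w) = r i * ratio w"
  by (simp add: ratio_def)

lemma r_bounds: "i \<in> {1..m} \<Longrightarrow> 0 < r i" "i \<in> {1..m} \<Longrightarrow> r i < 1"
  using ifs by (simp_all add: ss_ifs_def)

lemma ratio_pos: "set w \<subseteq> {1..m} \<Longrightarrow> 0 < ratio w"
  by (induction w) (auto simp: ratio_Cons intro!: mult_pos_pos r_bounds)

lemma m_pos: "1 \<le> m"
  using attractor by (cases "m = 0") (auto simp: is_attractor_def)

text \<open>\<open>\<rho>\<close> is the largest of the \<open>r i\<close>. The geometric decay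
  makes all cylinders of a given level uniformly small.\<close>

lemma ratio_le_power:
  obtains \<rho> where "0 < \<rho>" "\<rho> < 1" "\<And>w. set w \<subseteq> {1..m} \<Longrightarrow> ratio w \<le> \<rho> ^ length w"
proof
  define \<rho> where "\<rho> = Max (r ` {1..m})"
  have "\<rho> \<in> r ` {1..m}"
    unfolding \<rho>_def using m_pos by (intro Max_in) auto
  with r_bounds show "0 < \<rho>" "\<rho> < 1" by auto
  have "r i \<le> \<rho>" if "i \<in> {1..m}" for i
    unfolding \<rho>_def using that by (intro Max_ge) auto
  then show "ratio w \<le> \<rho> ^ length w" if "set w \<subseteq> {1..m}" for w
    using that
  proof (induction w)
    case (Cons i w)
    then have "r i * ratio w \<le> \<rho> * \<rho> ^ length w"
      using \<open>0 < \<rho>\<close> ratio_pos[of w] by (intro mult_mono) auto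
    then show ?case by (simp add: ratio_Cons)
  qed simp
qed

lemma ratio_less_1:
  assumes "w \<in> ifs_words m"
  shows "ratio w < 1"
proof -
  obtain \<rho> where \<rho>: "0 < \<rho>" "\<rho> < 1" "\<And>w. set w \<subseteq> {1..m} \<Longrightarrow> ratio w \<le> \<rho> ^ length w"
    using ratio_le_power by blast
  have "ratio w \<le> \<rho> ^ length w" "\<rho> ^ length w < 1"
    using assms \<rho> by (auto simp: in_ifs_words power_less_one_iff)
  then show ?thesis by simp
qed

text \<open>A lower bound on the ratio bounds the word length. This allows words to be selected by
  decreasing ratio.\<close>

lemma finite_ratio_ge:
  assumes "0 < \<epsilon>"
  shows "finite {w. set w \<subseteq> {1..m} \<and> \<epsilon> \<le> ratio w}"
proof -
  obtain \<rho> where \<rho>: "0 < \<rho>" "\<rho> < 1" "\<And>w. set w \<subseteq> {1..m} \<Longrightarrow> ratio w \<le> \<rho> ^ length w"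
    using ratio_le_power by blast
  obtain n where n: "\<rho> ^ n < \<epsilon>"
    using \<rho> assms real_arch_pow_inv by blast
  have "length w \<le> n" if "set w \<subseteq> {1..m}" "\<epsilon> \<le> ratio w" for w
  proof (rule ccontr)
    assume "\<not> length w \<le> n"
    then have "\<rho> ^ length w \<le> \<rho> ^ n"
      using \<rho> by (intro power_decreasing) auto
    with n that \<rho>(3)[of w] show False by linarith
  qed
  then show ?thesis
    by (intro finite_subset[OF _ finite_lists_length_le[of "{1..m}" n]]) auto
qed

section \<open>Cylinders and their metric properties\<close>

lemma orthogonal_T: "i \<in> {1..m} \<Longrightarrow> orthogonal_transformation (blinfun_apply (T i))"
  using ifs by (simp add: ss_ifs_def orthogonal_group_def)

lemma dist_word_map:
  "set w \<subseteq> {1..m} \<Longrightarrow> dist (word_map S w x) (word_map S w y) = ratio w * dist x y"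
proof (induction w)
  case (Cons i w)
  have "S i a - S i b = r i *\<^sub>R blinfun_apply (T i) (a - b)" for a b
    using ifs Cons.prems by (simp add: ss_ifs_def blinfun.diff_right algebra_simps)
  then have "dist (S i a) (S i b) = r i * dist a b" for a b
    using orthogonal_transformation_norm[OF orthogonal_T[of i]] r_bounds(1)[of i] Cons.prems
    by (simp add: dist_norm)
  with Cons show ?case by (simp add: word_map_Cons ratio_Cons)
qed simp

lemma K_eq: "K = (\<Union>i\<in>{1..m}. S i ` K)" and compact_K: "compact K" and K_nonempty: "K \<noteq> {}"
  using attractor by (simp_all add: is_attractor_def)

lemma compact_word_map:
  assumes "set w \<subseteq> {1..m}"
  shows "compact (word_map S w ` K)"
proof (rule compact_continuous_image[OF _ compact_K])
  have "(ratio w)-lipschitz_on K (word_map S w)"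
    using assms ratio_pos[OF assms] by (intro lipschitz_onI) (simp_all add: dist_word_map)
  then show "continuous_on K (word_map S w)"
    by (rule lipschitz_on_continuous_on)
qed

lemma word_map_in_K: "set w \<subseteq> {1..m} \<Longrightarrow> x \<in> K \<Longrightarrow> word_map S w x \<in> K"
proof (induction w)
  case (Cons i w)
  then have "S i (word_map S w x) \<in> (\<Union>i\<in>{1..m}. S i ` K)" by auto
  then show ?case by (simp only: word_map_Cons K_eq[symmetric])
qed simp

lemma cylinder_cover:
  "x \<in> K \<Longrightarrow> \<exists>w. length w = n \<and> set w \<subseteq> {1..m} \<and> x \<in> word_map S w ` K"
proof (induction n arbitrary: x)
  case (Suc n)
  then obtain i y where i: "i \<in> {1..m}" "y \<in> K" "x = S i y"
    using K_eq by blast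
  with Suc.IH[of y] obtain w where "length w = n" "set w \<subseteq> {1..m}" "y \<in> word_map S w ` K"
    by blast
  with i show ?case
    by (intro exI[of _ "i # w"]) (auto simp: word_map_Cons)
qed auto

lemma K_dist_bound:
  obtains D where "0 < D" "\<And>x y. x \<in> K \<Longrightarrow> y \<in> K \<Longrightarrow> dist x y \<le> D"
proof -
  obtain a e where e: "\<And>y. y \<in> K \<Longrightarrow> dist a y \<le> e"
    using compact_imp_bounded[OF compact_K] by (auto simp: bounded_def)
  show ?thesis
  \<comment> \<open>The added 1 makes the bound strictly positive; it serves as a divisor
    later.\<close>
  proof (rule that[of "2 * \<bar>e\<bar> + 1"])
    fix x y assume "x \<in> K" "y \<in> K"
    then show "dist x y \<le> 2 * \<bar>e\<bar> + 1"
      using e[of x] e[of y] dist_triangle3[of x y a] by linarith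
  qed simp
qed


section \<open>Disjoint cylinders and the dimension\<close>

text \<open>Guarantees that the infimum defining \<open>hausdorff_dim K\<close> runs over a nonempty
  set. The covers are the \<open>m ^ n\<close> balls of radius \<open>D * \<rho> ^ n\<close> around
  images of one point under the words of length \<open>n\<close>.\<close>

lemma hausdorff_measure_K_eq_0: "\<exists>u\<ge>0. hausdorff_measure u K = 0"
proof -
  obtain \<rho> where \<rho>: "0 < \<rho>" "\<rho> < 1" "\<And>w. set w \<subseteq> {1..m} \<Longrightarrow> ratio w \<le> \<rho> ^ length w"
    using ratio_le_power by blast
  obtain D where D: "0 < D" "\<And>x y. x \<in> K \<Longrightarrow> y \<in> K \<Longrightarrow> dist x y \<le> D"
    using K_dist_bound by blast
  obtain x0 where x0: "x0 \<in> K" using K_nonempty by auto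
  \<comment> \<open>With this \<open>k\<close>, the \<open>k\<close>-th powers of the sizes decay
    faster than the number \<open>m ^ n\<close> of words grows: their sum is a constant times
    \<open>q ^ n\<close> with \<open>q < 1\<close>.\<close>
  obtain k where k: "\<rho> ^ k < 1 / m"
    using \<rho> m_pos real_arch_pow_inv[of "1 / m" \<rho>] by auto
  define q where "q = m * \<rho> ^ k"
  have q: "0 < q" "q < 1"
    using k m_pos \<rho> by (auto simp: q_def field_simps)
  have "hausdorff_measure (real k) K = 0"
  proof (rule hausdorff_measure_eq_0I)
    fix \<eta> \<epsilon> :: real assume "0 < \<eta>" "0 < \<epsilon>"
    have "(\<lambda>n. 2 * (D * \<rho> ^ n)) \<longlonglongrightarrow> 2 * (D * 0)" "(\<lambda>n. (2 * D) ^ k * q ^ n) \<longlonglongrightarrow> (2 * D) ^ k * 0"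
      using \<rho> q by (intro tendsto_intros LIMSEQ_power_zero; simp)+
    then have "\<forall>\<^sub>F n in sequentially. 2 * (D * \<rho> ^ n) < \<eta> \<and> (2 * D) ^ k * q ^ n < \<epsilon>"
      using \<open>0 < \<eta>\<close> \<open>0 < \<epsilon>\<close> by (intro eventually_conj order_tendstoD) auto
    then obtain n where n: "2 * (D * \<rho> ^ n) < \<eta>" "(2 * D) ^ k * q ^ n < \<epsilon>"
      by (auto simp: eventually_sequentially)
    define I where "I = {w. set w \<subseteq> {1..m} \<and> length w = n}"
    have finI: "finite I" and cardI: "card I = m ^ n"
      by (auto simp: I_def finite_lists_length_eq card_lists_length_eq)
    have "K \<subseteq> (\<Union>w\<in>I. cball (word_map S w x0) (D * \<rho> ^ n))"
    proof
      fix x assume "x \<in> K"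
      then obtain w y where w: "w \<in> I" "y \<in> K" "x = word_map S w y"
        using cylinder_cover[of x n] by (auto simp: I_def)
      have "dist (word_map S w x0) x = ratio w * dist x0 y"
        using w by (simp add: dist_word_map I_def)
      also have "\<dots> \<le> \<rho> ^ n * D"
        using w \<rho> D x0 by (intro mult_mono) (auto simp: I_def)
      finally show "x \<in> (\<Union>w\<in>I. cball (word_map S w x0) (D * \<rho> ^ n))"
        using w by (auto simp: mult.commute)
    qed
    moreover have "(\<Sum>w\<in>G. (2 * (D * \<rho> ^ n)) powr real k) \<le> \<epsilon>" if "G \<subseteq> I" for G
    proof -
      have "(\<Sum>w\<in>G. (2 * (D * \<rho> ^ n)) powr real k) \<le> (\<Sum>w\<in>I. (2 * (D * \<rho> ^ n)) powr real k)"
        using that finI by (intro sum_mono2) auto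
      also have "\<dots> = real (m ^ n) * (2 * (D * \<rho> ^ n)) ^ k"
        using D \<rho> by (simp add: cardI powr_realpow)
      also have "\<dots> = (2 * D) ^ k * q ^ n"
        by (simp add: q_def power_mult_distrib power_mult[symmetric] mult.commute mult.left_commute)
      finally show ?thesis using n by simp
    qed
    ultimately show "\<exists>(I :: nat list set) z b. K \<subseteq> (\<Union>i\<in>I. cball (z i) (b i)) \<and>
        (\<forall>i\<in>I. 0 < b i \<and> 2 * b i \<le> \<eta>) \<and>
        (\<forall>G. finite G \<longrightarrow> G \<subseteq> I \<longrightarrow> (\<Sum>i\<in>G. (2 * b i) powr real k) \<le> \<epsilon>)"
      using n D \<rho>
      by (intro exI[of _ I] exI[of _ "\<lambda>w. word_map S w x0"] exI[of _ "\<lambda>_. D * \<rho> ^ n"]) auto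
  qed simp
  then show ?thesis by (intro exI[of _ "real k"]) simp
qed

lemma hausdorff_dim_nonneg: "0 \<le> hausdorff_dim K"
  unfolding hausdorff_dim_def using hausdorff_measure_K_eq_0 by (intro cInf_greatest) auto

text \<open>No \<open>u < s\<close> can have measure zero: at mesh 1 the premeasure for
  \<open>u\<close> dominates the one for \<open>s\<close>, and the measure dominates both.\<close>

lemma le_hausdorff_dim:
  assumes "0 < s" "0 < c" "ennreal c \<le> hausdorff_premeasure s 1 K"
  shows "s \<le> hausdorff_dim K"
  unfolding hausdorff_dim_def
proof (rule cInf_greatest)
  fix u assume "u \<in> {u. 0 \<le> u \<and> hausdorff_measure u K = 0}"
  then have u: "0 \<le> u" "hausdorff_measure u K = 0" by auto
  show "s \<le> u"
  proof (rule ccontr)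
    assume "\<not> s \<le> u"
    then have "ennreal c \<le> hausdorff_premeasure u 1 K"
      using assms u hausdorff_premeasure_antimono[of u s K] by auto
    also have "\<dots> \<le> hausdorff_measure u K"
      unfolding hausdorff_measure_def by (rule SUP_upper) simp
    finally show False using u assms by simp
  qed
qed (use hausdorff_measure_K_eq_0 in auto)

text \<open>Disjoint compact sets have positive distance. Being true for all small positive
  \<open>\<eta>\<close> is stable under finite conjunctions, which replaces an explicit minimum over
  pairs.\<close>

lemma cylinders_separated:
  assumes "finite J" "J \<subseteq> ifs_words m"
    and disj: "\<And>i j. i \<in> J \<Longrightarrow> j \<in> J \<Longrightarrow> i \<noteq> j \<Longrightarrow> word_map S i ` K \<inter> word_map S j ` K = {}"
  shows "\<exists>\<eta>>0. \<forall>i\<in>J. \<forall>j\<in>J. i \<noteq> j \<longrightarrow>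
    (\<forall>x\<in>word_map S i ` K. \<forall>y\<in>word_map S j ` K. \<eta> \<le> dist x y)"
proof -
  have "\<forall>\<^sub>F \<eta> in at_right (0::real). i \<noteq> j \<longrightarrow>
      (\<forall>x\<in>word_map S i ` K. \<forall>y\<in>word_map S j ` K. \<eta> \<le> dist x y)"
    if ij: "i \<in> J" "j \<in> J" for i j
  proof (cases "i = j")
    case False
    have "compact (word_map S i ` K)" "closed (word_map S j ` K)"
      using compact_word_map ij assms(2) by (auto simp: in_ifs_words compact_imp_closed)
    from separate_compact_closed[OF this disj[OF ij False]] obtain d where d: "0 < d"
      "\<And>x y. x \<in> word_map S i ` K \<Longrightarrow> y \<in> word_map S j ` K \<Longrightarrow> d \<le> dist x y"
      by auto
    have "\<forall>\<^sub>F \<eta> in at_right 0. \<eta> < d"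
      using d(1) by (auto simp: eventually_at_right_field)
    then show ?thesis
      by eventually_elim (use d(2) in force)
  qed simp
  then have "\<forall>\<^sub>F \<eta> in at_right (0::real). \<forall>i\<in>J. \<forall>j\<in>J. i \<noteq> j \<longrightarrow>
      (\<forall>x\<in>word_map S i ` K. \<forall>y\<in>word_map S j ` K. \<eta> \<le> dist x y)"
    using \<open>finite J\<close> by (intro eventually_ball_finite ballI)
  then have "\<forall>\<^sub>F \<eta> in at_right (0::real). 0 < \<eta> \<and> (\<forall>i\<in>J. \<forall>j\<in>J. i \<noteq> j \<longrightarrow>
      (\<forall>x\<in>word_map S i ` K. \<forall>y\<in>word_map S j ` K. \<eta> \<le> dist x y))"
    by (intro eventually_conj eventually_at_right_less)
  then show ?thesis
    using eventually_happens'[OF trivial_limit_at_right_real] by fast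
qed

text \<open>
  A cover by sets smaller than the gaps between the cylinders splits into covers of the individual
  cylinders. One of these, blown up to a cover of \<open>K\<close>, has at most the original \<open>s\<close>-sum and fewer
  members.
\<close>

lemma cover_sum_ge:
  assumes J: "finite J" "J \<subseteq> ifs_words m" and "0 < s" and sum: "1 \<le> (\<Sum>j\<in>J. ratio j powr s)"
    and "0 < \<eta>"
    and sep: "\<And>i j x y. i \<in> J \<Longrightarrow> j \<in> J \<Longrightarrow> i \<noteq> j \<Longrightarrow> x \<in> word_map S i ` K \<Longrightarrow>
      y \<in> word_map S j ` K \<Longrightarrow> \<eta> \<le> dist x y"
    and "finite (I :: 'i set)" "K \<subseteq> (\<Union>i\<in>I. U i)"
    and "\<And>i. i \<in> I \<Longrightarrow> 0 < b i"
    and "\<And>i x y. i \<in> I \<Longrightarrow> x \<in> U i \<Longrightarrow> y \<in> U i \<Longrightarrow> dist x y \<le> b i"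
  shows "\<eta> powr s \<le> (\<Sum>i\<in>I. b i powr s)"
  using assms(7-10)
\<comment> \<open>Induction over proper subsets of the index set; \<open>U\<close> and
  \<open>b\<close> vary because the blow-up replaces them.\<close>
proof (induction I arbitrary: U b rule: finite_psubset_induct)
  case (psubset I)
  note cov = psubset.prems(1) and b = psubset.prems(2,3)
  have ratio: "0 < ratio j" "ratio j < 1" if "j \<in> J" for j
    using ratio_pos[of j] ratio_less_1[of j] that J by (auto simp: in_ifs_words)
  show ?case
  proof (cases "\<exists>i\<in>I. \<eta> \<le> b i")
    case True
    then obtain i where i: "i \<in> I" "\<eta> \<le> b i" by auto
    have "\<eta> powr s \<le> b i powr s"
      using i \<open>0 < \<eta>\<close> \<open>0 < s\<close> by (intro powr_mono2) auto
    also have "\<dots> \<le> (\<Sum>i\<in>I. b i powr s)"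
      using i psubset.hyps by (intro member_le_sum) auto
    finally show ?thesis .
  next
    case False
    \<comment> \<open>The members of the cover that meet cylinder \<open>j\<close>. All sizes are
      below the gap \<open>\<eta>\<close> here, so no member meets two cylinders.\<close>
    define N where "N j = {i\<in>I. U i \<inter> word_map S j ` K \<noteq> {}}" for j
    have N_disj: "N j \<inter> N k = {}" if "j \<in> J" "k \<in> J" "j \<noteq> k" for j k
    proof (rule ccontr)
      assume "N j \<inter> N k \<noteq> {}"
      then obtain i x y where i: "i \<in> I" "x \<in> U i" "y \<in> U i" "x \<in> word_map S j ` K" "y \<in> word_map S k ` K"
        unfolding N_def by blast
      with sep[OF that, of x y] b(2)[of i x y] False show False by force
    qed
    have cov_j: "\<exists>i\<in>N j. word_map S j x \<in> U i" if "j \<in> J" "x \<in> K" for j x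
    proof -
      have "word_map S j x \<in> K"
        using that J word_map_in_K by (auto simp: in_ifs_words)
      with cov obtain i where "i \<in> I" "word_map S j x \<in> U i" by auto
      then show ?thesis using that by (auto simp: N_def)
    qed
    then have N_ne: "N j \<noteq> {}" if "j \<in> J" for j
      using K_nonempty that by blast
    have Npsub: "N j \<subset> I" if j: "j \<in> J" for j
    proof -
      \<comment> \<open>All ratios are below 1, so a single word cannot reach the sum 1. A second
        cylinder needs members of its own, hence \<open>N j\<close> is a proper subset of
        \<open>I\<close>.\<close>
      have "J \<noteq> {j}"
      proof
        assume "J = {j}"
        then have "1 \<le> ratio j powr s" using sum by simp
        then show False using ratio[OF j] \<open>0 < s\<close> powr_less_mono2[of s "ratio j" 1] by simp
      qed
      with j obtain k where "k \<in> J" "k \<noteq> j" by blast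
      with N_disj[OF j, of k] N_ne[of k] have "N j \<inter> N k = {}" "N k \<noteq> {}" by auto
      moreover have "N j \<subseteq> I" "N k \<subseteq> I" by (auto simp: N_def)
      ultimately show ?thesis by blast
    qed
    \<comment> \<open>Otherwise summing over \<open>j\<close> would give the disjoint sets
      \<open>N j\<close> a larger total than \<open>I\<close>.\<close>
    have "\<exists>j\<in>J. (\<Sum>i\<in>N j. b i powr s) \<le> ratio j powr s * (\<Sum>i\<in>I. b i powr s)"
    proof (rule ccontr)
      assume "\<not> ?thesis"
      then have less: "ratio j powr s * (\<Sum>i\<in>I. b i powr s) < (\<Sum>i\<in>N j. b i powr s)" if "j \<in> J" for j
        using that by auto
      have "J \<noteq> {}" using sum by auto
      have "(\<Sum>i\<in>I. b i powr s) \<le> (\<Sum>j\<in>J. ratio j powr s) * (\<Sum>i\<in>I. b i powr s)"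
        using mult_right_mono[OF sum, of "\<Sum>i\<in>I. b i powr s"] by (simp add: sum_nonneg)
      also have "\<dots> < (\<Sum>j\<in>J. \<Sum>i\<in>N j. b i powr s)"
        unfolding sum_distrib_right using less J \<open>J \<noteq> {}\<close> by (intro sum_strict_mono) auto
      also have "\<dots> = (\<Sum>i\<in>(\<Union>j\<in>J. N j). b i powr s)"
        using J N_disj psubset.hyps by (intro sum.UNION_disjoint[symmetric]) (auto simp: N_def)
      also have "\<dots> \<le> (\<Sum>i\<in>I. b i powr s)"
        using psubset.hyps by (intro sum_mono2) (auto simp: N_def)
      finally show False by simp
    qed
    then obtain j where j: "j \<in> J" "(\<Sum>i\<in>N j. b i powr s) \<le> ratio j powr s * (\<Sum>i\<in>I. b i powr s)"
      by blast
    have words: "set j \<subseteq> {1..m}" using subsetD[OF J(2) j(1)] by (simp add: in_ifs_words)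
    \<comment> \<open>Preimages under \<open>word_map S j\<close> cover \<open>K\<close>, and their
      size bounds are divided by \<open>ratio j\<close>.\<close>
    have "\<eta> powr s \<le> (\<Sum>i\<in>N j. (b i / ratio j) powr s)"
    proof (rule psubset.IH[OF Npsub[OF j(1)]])
      show "K \<subseteq> (\<Union>i\<in>N j. word_map S j -` U i)"
        using cov_j[OF j(1)] by auto
      show "0 < b i / ratio j" if "i \<in> N j" for i
        using that b(1)[of i] ratio[OF j(1)] by (auto simp: N_def)
      show "dist x y \<le> b i / ratio j"
        if "i \<in> N j" "x \<in> word_map S j -` U i" "y \<in> word_map S j -` U i" for i x y
        using that b(2)[of i "word_map S j x" "word_map S j y"] ratio[OF j(1)] dist_word_map[OF words, of x y]
        by (auto simp: N_def field_simps)
    qed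
    also have "\<dots> = (\<Sum>i\<in>N j. b i powr s) / ratio j powr s"
      by (simp add: sum_divide_distrib powr_divide)
    also have "\<dots> \<le> (\<Sum>i\<in>I. b i powr s)"
      using j ratio[OF j(1)] by (simp add: field_simps)
    finally show ?thesis .
  qed
qed

text \<open>If the sum exceeded 1, continuity in the exponent would keep it above 1 at some
  \<open>s\<close> beyond the dimension; \<open>cover_sum_ge\<close> would then bound the premeasure
  from below and force the dimension up to \<open>s\<close>.\<close>

lemma sum_ratio_powr_dim_le_1:
  assumes J: "finite J" "J \<subseteq> ifs_words m"
    and disj: "\<And>i j. i \<in> J \<Longrightarrow> j \<in> J \<Longrightarrow> i \<noteq> j \<Longrightarrow> word_map S i ` K \<inter> word_map S j ` K = {}"
  shows "(\<Sum>j\<in>J. ratio j powr hausdorff_dim K) \<le> 1"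
proof (rule ccontr)
  let ?t = "hausdorff_dim K"
  assume "\<not> ?thesis"
  then have gt: "1 < (\<Sum>j\<in>J. ratio j powr ?t)" by simp
  have pos: "ratio j \<noteq> 0" if "j \<in> J" for j
    using that J ratio_pos[of j] by (auto simp: in_ifs_words)
  have "((\<lambda>s. \<Sum>j\<in>J. ratio j powr s) \<longlongrightarrow> (\<Sum>j\<in>J. ratio j powr ?t)) (at_right ?t)"
    using pos by (auto intro!: tendsto_intros)
  then have "\<forall>\<^sub>F s in at_right ?t. 1 < (\<Sum>j\<in>J. ratio j powr s)"
    using gt by (rule order_tendstoD)
  then have "\<forall>\<^sub>F s in at_right ?t. 1 < (\<Sum>j\<in>J. ratio j powr s) \<and> ?t < s"
    by (intro eventually_conj eventually_at_right_less)
  then obtain s where s: "1 < (\<Sum>j\<in>J. ratio j powr s)" "?t < s"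
    using eventually_happens'[OF trivial_limit_at_right_real] by fast
  have "0 < s" using s hausdorff_dim_nonneg by linarith
  obtain \<eta> where \<eta>: "0 < \<eta>" "\<forall>i\<in>J. \<forall>j\<in>J. i \<noteq> j \<longrightarrow>
      (\<forall>x\<in>word_map S i ` K. \<forall>y\<in>word_map S j ` K. \<eta> \<le> dist x y)"
    using cylinders_separated[OF J disj] by blast
  have "ennreal (\<eta> powr s) \<le> hausdorff_premeasure s 1 K"
  proof (rule hausdorff_premeasure_ge[OF compact_K \<open>0 < s\<close>])
    fix I :: "nat set" and U b
    assume "finite I" "K \<subseteq> (\<Union>i\<in>I. U i)"
      "\<And>i. i \<in> I \<Longrightarrow> 0 < b i \<and> (\<forall>x\<in>U i. \<forall>y\<in>U i. dist x y \<le> b i)"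
    then show "\<eta> powr s \<le> (\<Sum>i\<in>I. b i powr s)"
      using s \<eta> by (intro cover_sum_ge[OF J \<open>0 < s\<close> _ \<open>0 < \<eta>\<close>, where U = U]) auto
  qed
  then have "s \<le> ?t"
    using \<eta> \<open>0 < s\<close> by (intro le_hausdorff_dim) auto
  with s show False by simp
qed

end

section \<open>Orthogonal parts\<close>

text \<open>Left translation is an isometry, so group elements can be compared after cancelling a
  common left factor.\<close>

lemma norm_orthogonal_compose:
  assumes "f \<in> carrier orthogonal_group"
  shows "norm (f o\<^sub>L h) = norm h"
  using assms
  by (simp add: norm_blinfun.rep_eq onorm_def orthogonal_group_def orthogonal_transformation_norm)

lemma norm_orthogonal_le_1:
  assumes "f \<in> carrier orthogonal_group"
  shows "norm f \<le> 1"
  using assms by (intro norm_blinfun_bound) (auto simp: orthogonal_group_def orthogonal_transformation_norm)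

lemma orthogonal_compose_inv:
  assumes "f \<in> carrier orthogonal_group"
  shows "f o\<^sub>L inv\<^bsub>orthogonal_group\<^esub> f = id_blinfun"
  using group.r_inv[OF group_orthogonal_group assms] by (simp add: orthogonal_group_def)

context self_similar_set
begin

section \<open>Approximating group elements by words\<close>

lemma T_in_group: "i \<in> {1..m} \<Longrightarrow> T i \<in> carrier orthogonal_group"
  using ifs by (simp add: ss_ifs_def)

lemma word_orth_in_group:
  assumes "set w \<subseteq> {1..m}"
  shows "word_orth T w \<in> transformation_group m T"
  using assms
proof (induction w)
  case Nil
  show ?case
    using generate.one[of orthogonal_group "T ` {1..m}"]
    by (simp add: transformation_group_def orthogonal_group_def)
next
  case (Cons i w)
  then have "T i \<in> generate orthogonal_group (T ` {1..m})"
    "word_orth T w \<in> generate orthogonal_group (T ` {1..m})"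
    by (auto intro: generate.incl simp: transformation_group_def)
  from generate.eng[OF this] show ?case
    by (simp add: word_orth_Cons transformation_group_def orthogonal_group_def)
qed

lemma transformation_group_subset: "transformation_group m T \<subseteq> carrier orthogonal_group"
  unfolding transformation_group_def
  using group.generate_incl[OF group_orthogonal_group] T_in_group by blast

lemmas word_orth_orthogonal = subsetD[OF transformation_group_subset word_orth_in_group]

text \<open>The powers of \<open>T i\<close> lie in a compact ball, so a subsequence is Cauchy;
  cancelling the lower of two close powers leaves a power close to the identity.\<close>

lemma power_close_to_id:
  assumes i: "i \<in> {1..m}" and "0 < \<epsilon>"
  shows "\<exists>n\<ge>k. norm (word_orth T (replicate n i) - id_blinfun) < \<epsilon>"
proof -
  define x where "x n = word_orth T (replicate n i)" for n
  have x: "x n \<in> carrier orthogonal_group" for n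
    unfolding x_def using i by (intro word_orth_orthogonal) auto
  have "range x \<subseteq> cball 0 1"
    using norm_orthogonal_le_1[OF x] by auto
  moreover have "seq_compact (cball (0 :: 'a \<Rightarrow>\<^sub>L 'a) 1)"
    by (simp add: compact_imp_seq_compact)
  ultimately obtain l \<sigma> where \<sigma>: "strict_mono (\<sigma> :: nat \<Rightarrow> nat)" "(x \<circ> \<sigma>) \<longlonglongrightarrow> l"
    by (meson range_subsetD seq_compactE)
  then have "Cauchy (x \<circ> \<sigma>)" by (intro LIMSEQ_imp_Cauchy)
  then obtain M where M: "\<And>p q. p \<ge> M \<Longrightarrow> q \<ge> M \<Longrightarrow> dist (x (\<sigma> p)) (x (\<sigma> q)) < \<epsilon>"
    using \<open>0 < \<epsilon>\<close> unfolding Cauchy_def o_def by blast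
  \<comment> \<open>The two terms are \<open>k\<close> indices apart in the subsequence, so by
    strict monotonicity their exponents differ by at least \<open>k\<close>.\<close>
  define n where "n = \<sigma> (M + k) - \<sigma> M"
  have "\<sigma> M + k \<le> \<sigma> (M + k)" for k
  proof (induction k)
    case (Suc k)
    then show ?case using strict_monoD[OF \<sigma>(1), of "M + k" "Suc (M + k)"] by simp
  qed simp
  then have n: "\<sigma> (M + k) = \<sigma> M + n" "k \<le> n"
    unfolding n_def by (metis add_leD1 le_add_diff_inverse, metis add_le_imp_le_diff add.commute)
  have "x (\<sigma> M) o\<^sub>L (x n - id_blinfun) = x (\<sigma> (M + k)) - x (\<sigma> M)"
    by (auto simp: x_def n replicate_add word_orth_append blinfun.diff_right blinfun.diff_left intro!: blinfun_eqI)
  then have "norm (x n - id_blinfun) = dist (x (\<sigma> (M + k))) (x (\<sigma> M))"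
    using norm_orthogonal_compose[OF x, of "\<sigma> M" "x n - id_blinfun"] by (simp add: dist_norm)
  also have "\<dots> < \<epsilon>" by (rule M) auto
  finally show ?thesis using n by (auto simp: x_def)
qed

text \<open>
  In a compact group, the closure of a semigroup is a group: some high power of each \<open>T i\<close>
  is close to the identity, and the preceding power is then close to the inverse.
\<close>

lemma words_dense_in_group:
  assumes "g \<in> transformation_group m T" "0 < \<epsilon>"
  shows "\<exists>w\<in>ifs_words m. norm (word_orth T w - g) < \<epsilon>"
  using assms unfolding transformation_group_def
proof (induction arbitrary: \<epsilon> rule: generate.induct)
  case one
  \<comment> \<open>The empty word is excluded from \<open>ifs_words\<close>, so a positive power
    has to approximate the identity.\<close>
  obtain n where "n \<ge> 1" "norm (word_orth T (replicate n 1) - id_blinfun) < \<epsilon>"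
    using power_close_to_id[of 1 \<epsilon> 1] m_pos one by auto
  then show ?case
    using m_pos
    by (intro bexI[of _ "replicate n 1"]) (auto simp: in_ifs_words orthogonal_group_def)
next
  case (incl h)
  then obtain i where "i \<in> {1..m}" "h = T i" by auto
  moreover have "T i o\<^sub>L id_blinfun = T i" by (rule blinfun_eqI) simp
  ultimately show ?case using incl
    by (intro bexI[of _ "[i]"]) (auto simp: in_ifs_words word_orth_Cons)
next
  case (inv h)
  then obtain i where i: "i \<in> {1..m}" "h = T i" by auto
  \<comment> \<open>At least two letters, so that deleting one leaves a nonempty word.\<close>
  obtain n where n: "n \<ge> 2" "norm (word_orth T (replicate n i) - id_blinfun) < \<epsilon>"
    using power_close_to_id[OF i(1), of \<epsilon> 2] inv by auto
  define w where "w = replicate (n - 1) i"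
  let ?g = "inv\<^bsub>orthogonal_group\<^esub> (T i)"
  have "replicate n i = i # w" using n by (cases n) (auto simp: w_def)
  then have "T i o\<^sub>L (word_orth T w - ?g) = word_orth T (replicate n i) - (T i o\<^sub>L ?g)"
    by (auto simp: word_orth_Cons blinfun.diff_right blinfun.diff_left intro!: blinfun_eqI)
  then have "norm (word_orth T w - ?g) = norm (word_orth T (replicate n i) - id_blinfun)"
    using norm_orthogonal_compose[OF T_in_group[OF i(1)], of "word_orth T w - ?g"]
    by (simp add: orthogonal_compose_inv[OF T_in_group[OF i(1)]])
  then show ?case
    using n i by (intro bexI[of _ w]) (auto simp: w_def in_ifs_words)
next
  case (eng g h)
  obtain u w where u: "u \<in> ifs_words m" "norm (word_orth T u - g) < \<epsilon> / 2"
    and w: "w \<in> ifs_words m" "norm (word_orth T w - h) < \<epsilon> / 2"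
    using eng.IH[of "\<epsilon> / 2"] eng.prems by auto
  \<comment> \<open>One factor is changed at a time; the unchanged factor is orthogonal and does not
    enlarge the error.\<close>
  have "word_orth T (u @ w) - (g o\<^sub>L h) =
      ((word_orth T u - g) o\<^sub>L word_orth T w) + (g o\<^sub>L (word_orth T w - h))"
    by (auto simp: word_orth_append blinfun.diff_right blinfun.diff_left blinfun.add_left intro!: blinfun_eqI)
  then have "norm (word_orth T (u @ w) - (g o\<^sub>L h)) \<le>
      norm ((word_orth T u - g) o\<^sub>L word_orth T w) + norm (g o\<^sub>L (word_orth T w - h))"
    by (simp add: norm_triangle_ineq)
  also have "norm ((word_orth T u - g) o\<^sub>L word_orth T w) \<le> norm (word_orth T u - g) * 1"
    using w norm_orthogonal_le_1[OF word_orth_orthogonal[of w]]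
    by (intro order_trans[OF norm_blinfun_compose] mult_left_mono) (auto simp: in_ifs_words)
  also have "norm (g o\<^sub>L (word_orth T w - h)) = norm (word_orth T w - h)"
    using eng.hyps transformation_group_subset
    by (intro norm_orthogonal_compose) (auto simp: transformation_group_def)
  finally have "norm (word_orth T (u @ w) - (g o\<^sub>L h)) < \<epsilon>"
    using u w by simp
  then show ?case
    using u w by (intro bexI[of _ "u @ w"]) (auto simp: in_ifs_words orthogonal_group_def)
qed

text \<open>For \<open>g\<close> in the group close to \<open>Q\<close>, let \<open>w\<close>
  approximate the inverse of \<open>word_orth T j\<close> times \<open>g\<close>. Translating back
  by \<open>word_orth T j\<close> preserves the error.\<close>

lemma word_extension_close:
  assumes "Q \<in> closure (transformation_group m T)" "0 < \<epsilon>" "set j \<subseteq> {1..m}"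
  shows "\<exists>w\<in>ifs_words m. norm (word_orth T (j @ w) - Q) < \<epsilon>"
proof -
  let ?T = "word_orth T j" and ?G = "orthogonal_group :: ('a \<Rightarrow>\<^sub>L 'a) monoid"
  obtain g where g: "g \<in> transformation_group m T" "dist g Q < \<epsilon> / 2"
    using assms closure_approachable[of Q "transformation_group m T"] half_gt_zero by blast
  note orth = word_orth_orthogonal[OF assms(3)]
  have "inv\<^bsub>?G\<^esub> ?T \<in> transformation_group m T"
    unfolding transformation_group_def
  proof (rule group.generate_m_inv_closed[OF group_orthogonal_group])
    show "T ` {1..m} \<subseteq> carrier ?G" using T_in_group by blast
    show "?T \<in> generate ?G (T ` {1..m})"
      using word_orth_in_group[OF assms(3)] by (simp add: transformation_group_def)
  qed
  with g(1) have "inv\<^bsub>?G\<^esub> ?T o\<^sub>L g \<in> transformation_group m T"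
    using generate.eng[of "inv\<^bsub>?G\<^esub> ?T" ?G _ g]
    by (simp add: transformation_group_def orthogonal_group_def)
  then obtain w where w: "w \<in> ifs_words m" "norm (word_orth T w - (inv\<^bsub>?G\<^esub> ?T o\<^sub>L g)) < \<epsilon> / 2"
    using words_dense_in_group half_gt_zero[OF assms(2)] by blast
  have "?T o\<^sub>L (word_orth T w - (inv\<^bsub>?G\<^esub> ?T o\<^sub>L g)) = word_orth T (j @ w) - ((?T o\<^sub>L inv\<^bsub>?G\<^esub> ?T) o\<^sub>L g)"
    by (auto simp: word_orth_append blinfun.diff_right blinfun.diff_left intro!: blinfun_eqI)
  also have "\<dots> = word_orth T (j @ w) - g"
    by (auto simp: orthogonal_compose_inv[OF orth] blinfun.diff_left intro!: blinfun_eqI)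
  finally have "norm (word_orth T (j @ w) - g) < \<epsilon> / 2"
    using w(2) norm_orthogonal_compose[OF orth, of "word_orth T w - (inv\<^bsub>?G\<^esub> ?T o\<^sub>L g)"] by simp
  then have "norm (word_orth T (j @ w) - Q) < \<epsilon>"
    using g(2) norm_triangle_ineq[of "word_orth T (j @ w) - g" "g - Q"] by (simp add: dist_norm)
  with w(1) show ?thesis by blast
qed

text \<open>The orthogonal parts of all words have compact closure, so those of a finite set
  \<open>B\<close> of words form a \<open>\<delta> / 2\<close>-net. A word \<open>j\<close> borrows
  the extension of a nearby \<open>k \<in> B\<close>, hence only finitely many extensions
  occur.\<close>

lemma uniform_word_extension:
  assumes Q: "Q \<in> closure (transformation_group m T)" and "0 < \<delta>"
  obtains c where "0 < c"
    "\<And>j. set j \<subseteq> {1..m} \<Longrightarrow> \<exists>w\<in>ifs_words m. c \<le> ratio w \<and> norm (word_orth T (j @ w) - Q) < \<delta>"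
proof -
  define A where "A = {w. set w \<subseteq> {1..m}}"
  have "bounded (word_orth T ` A)"
    using norm_orthogonal_le_1[OF word_orth_orthogonal]
    by (intro boundedI[of _ 1]) (auto simp: A_def)
  then have compact: "compact (closure (word_orth T ` A))"
    by simp
  have cover: "closure (word_orth T ` A) \<subseteq> (\<Union>j\<in>A. ball (word_orth T j) (\<delta> / 2))"
  proof
    fix f assume "f \<in> closure (word_orth T ` A)"
    then obtain j where "j \<in> A" "dist (word_orth T j) f < \<delta> / 2"
      using half_gt_zero[OF \<open>0 < \<delta>\<close>] unfolding closure_approachable by blast
    then show "f \<in> (\<Union>j\<in>A. ball (word_orth T j) (\<delta> / 2))" by auto
  qed
  obtain B where B: "B \<subseteq> A" "finite B"
    "closure (word_orth T ` A) \<subseteq> (\<Union>j\<in>B. ball (word_orth T j) (\<delta> / 2))"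
    by (rule compactE_image[OF compact _ cover]) (rule open_ball)
  have "\<forall>j\<in>B. \<exists>w\<in>ifs_words m. norm (word_orth T (j @ w) - Q) < \<delta> / 2"
    using B(1) word_extension_close[OF Q half_gt_zero[OF \<open>0 < \<delta>\<close>]] by (auto simp: A_def)
  then obtain e where e: "\<And>j. j \<in> B \<Longrightarrow> e j \<in> ifs_words m"
    "\<And>j. j \<in> B \<Longrightarrow> norm (word_orth T (j @ e j) - Q) < \<delta> / 2"
    by metis
  \<comment> \<open>A minimum over finitely many positive numbers; the inserted 1 makes the set
    nonempty by construction.\<close>
  define c where "c = Min (insert 1 ((ratio \<circ> e) ` B))"
  show ?thesis
  proof
    show "0 < c"
      using B(2) e(1) ratio_pos by (auto simp: c_def in_ifs_words)
    fix j assume j: "set j \<subseteq> {1..m}"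
    then have "word_orth T j \<in> closure (word_orth T ` A)"
      by (intro subsetD[OF closure_subset] imageI) (simp add: A_def)
    then obtain k where k: "k \<in> B" "dist (word_orth T k) (word_orth T j) < \<delta> / 2"
      using B by auto
    \<comment> \<open>The first summand is the cost of exchanging \<open>k\<close> for
      \<open>j\<close>, the second the error of the extension chosen for \<open>k\<close>.\<close>
    have "word_orth T (j @ e k) - Q =
        ((word_orth T j - word_orth T k) o\<^sub>L word_orth T (e k)) + (word_orth T (k @ e k) - Q)"
      by (auto simp: word_orth_append blinfun.diff_left blinfun.add_left intro!: blinfun_eqI)
    then have "norm (word_orth T (j @ e k) - Q) \<le>
        norm ((word_orth T j - word_orth T k) o\<^sub>L word_orth T (e k)) + norm (word_orth T (k @ e k) - Q)"
      by (simp only: norm_triangle_ineq)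
    also have "norm ((word_orth T j - word_orth T k) o\<^sub>L word_orth T (e k)) \<le>
        norm (word_orth T j - word_orth T k) * 1"
      using e(1)[OF k(1)] norm_orthogonal_le_1[OF word_orth_orthogonal[of "e k"]]
      by (intro order_trans[OF norm_blinfun_compose] mult_left_mono) (auto simp: in_ifs_words)
    finally have "norm (word_orth T (j @ e k) - Q) < \<delta>"
      using k(2) e(2)[OF k(1)] by (simp add: dist_norm norm_minus_commute)
    moreover have "c \<le> ratio (e k)"
      unfolding c_def using B k by (intro Min_le) auto
    ultimately show "\<exists>w\<in>ifs_words m. c \<le> ratio w \<and> norm (word_orth T (j @ w) - Q) < \<delta>"
      using e(1)[OF k(1)] by blast
  qed
qed


section \<open>Disjoint cylinders with prescribed orthogonal part\<close>

text \<open>A finite union of cylinders is closed, so a ball around \<open>x\<close> misses it, and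
  a cylinder of high level through \<open>x\<close> fits into that ball.\<close>

lemma small_cylinder_avoiding:
  assumes "x \<in> K" "finite F" "F \<subseteq> ifs_words m" "x \<notin> (\<Union>w\<in>F. word_map S w ` K)"
  shows "\<exists>j. set j \<subseteq> {1..m} \<and> x \<in> word_map S j ` K \<and>
    word_map S j ` K \<inter> (\<Union>w\<in>F. word_map S w ` K) = {}"
proof -
  obtain \<rho> where \<rho>: "0 < \<rho>" "\<rho> < 1" "\<And>w. set w \<subseteq> {1..m} \<Longrightarrow> ratio w \<le> \<rho> ^ length w"
    using ratio_le_power by blast
  obtain D where D: "0 < D" "\<And>x y. x \<in> K \<Longrightarrow> y \<in> K \<Longrightarrow> dist x y \<le> D"
    using K_dist_bound by blast
  have "closed (\<Union>w\<in>F. word_map S w ` K)"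
    using assms(2,3) compact_word_map by (intro closed_UN compact_imp_closed ballI) (auto simp: in_ifs_words)
  then obtain e where e: "0 < e" "ball x e \<inter> (\<Union>w\<in>F. word_map S w ` K) = {}"
    using assms(4) open_contains_ball[of "- (\<Union>w\<in>F. word_map S w ` K)"]
    by (metis ComplI Int_commute disjoint_eq_subset_Compl open_Compl)
  obtain n where n: "\<rho> ^ n < e / D"
    using real_arch_pow_inv[of "e / D" \<rho>] \<rho> D e by auto
  obtain j where j: "length j = n" "set j \<subseteq> {1..m}" "x \<in> word_map S j ` K"
    using cylinder_cover[OF assms(1)] by blast
  obtain a where a: "a \<in> K" "x = word_map S j a" using j by auto
  have "word_map S j y \<in> ball x e" if "y \<in> K" for y
  proof -
    have "dist x (word_map S j y) = ratio j * dist a y"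
      using a j by (simp add: dist_word_map)
    also have "\<dots> \<le> \<rho> ^ n * D"
      using \<rho> j D a that by (intro mult_mono) auto
    also have "\<dots> < e" using n D by (simp add: field_simps)
    finally show ?thesis by simp
  qed
  with e j show ?thesis by blast
qed

text \<open>The Vitali argument. An uncovered point lies in a cylinder \<open>j\<close> avoiding the
  finite family \<open>F\<close>; the word \<open>u\<close> that \<open>large\<close> provides for
  \<open>j\<close> is therefore outside \<open>F\<close>, and an enlarged ball for \<open>u\<close>
  reaches the point.\<close>

lemma uncovered_part_null:
  assumes W: "W \<subseteq> ifs_words m"
    and disj: "\<And>i j. i \<in> W \<Longrightarrow> j \<in> W \<Longrightarrow> i \<noteq> j \<Longrightarrow> word_map S i ` K \<inter> word_map S j ` K = {}"
    and "0 < c"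
    and large: "\<And>j. set j \<subseteq> {1..m} \<Longrightarrow>
      \<exists>u\<in>W. word_map S u ` K \<inter> word_map S j ` K \<noteq> {} \<and> c * ratio j \<le> ratio u"
  shows "hausdorff_measure (hausdorff_dim K) (K - (\<Union>w\<in>W. word_map S w ` K)) = 0"
proof (rule hausdorff_measure_eq_0I[OF hausdorff_dim_nonneg])
  let ?t = "hausdorff_dim K"
  fix \<eta> \<epsilon> :: real assume "0 < \<eta>" "0 < \<epsilon>"
  obtain D where D: "0 < D" "\<And>x y. x \<in> K \<Longrightarrow> y \<in> K \<Longrightarrow> dist x y \<le> D"
    using K_dist_bound by blast
  obtain x0 where x0: "x0 \<in> K" using K_nonempty by auto
  have W_pos: "0 < ratio w" if "w \<in> W" for w
    using subsetD[OF W that] by (simp add: in_ifs_words ratio_pos)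
  \<comment> \<open>Relative to \<open>ratio u\<close>, \<open>D\<close> bounds the way across the
    cylinder of \<open>u\<close>, and \<open>D / c\<close> the way across that of
    \<open>j\<close>.\<close>
  define C where "C = D * (1 / c + 1)"
  have "0 < C" using D \<open>0 < c\<close> by (simp add: C_def add_pos_pos)
  \<comment> \<open>Chosen so that the factor \<open>(2 * C) powr ?t\<close> from the radii turns
    the tail bound into \<open>\<epsilon>\<close>.\<close>
  define \<epsilon>' where "\<epsilon>' = \<epsilon> / (2 * C) powr ?t"
  have "0 < \<epsilon>'" using \<open>0 < C\<close> \<open>0 < \<epsilon>\<close> by (simp add: \<epsilon>'_def)
  have "(\<Sum>w\<in>G. ratio w powr ?t) \<le> 1" if "finite G" "G \<subseteq> W" for G
    using that W by (intro sum_ratio_powr_dim_le_1 disj) auto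
  then obtain F1 where F1: "finite F1" "F1 \<subseteq> W"
    "\<And>G. finite G \<Longrightarrow> G \<subseteq> W - F1 \<Longrightarrow> (\<Sum>w\<in>G. ratio w powr ?t) \<le> \<epsilon>'"
    using finite_subset_small_tail[of W "\<lambda>w. ratio w powr ?t" 1 \<epsilon>'] \<open>0 < \<epsilon>'\<close> by metis
  \<comment> \<open>\<open>F1\<close> makes the tail sums small; the added words are those with
    \<open>2 * (C * ratio w)\<close> at least \<open>\<eta>\<close>.\<close>
  define F where "F = F1 \<union> {w\<in>W. \<eta> / (2 * C) \<le> ratio w}"
  have "finite {w\<in>W. \<eta> / (2 * C) \<le> ratio w}"
  proof (rule finite_subset[OF _ finite_ratio_ge])
    show "{w\<in>W. \<eta> / (2 * C) \<le> ratio w} \<subseteq> {w. set w \<subseteq> {1..m} \<and> \<eta> / (2 * C) \<le> ratio w}"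
      using W in_ifs_words[of _ m] by blast
  qed (use \<open>0 < C\<close> \<open>0 < \<eta>\<close> in simp)
  then have F: "finite F" "F \<subseteq> W"
    using F1 by (auto simp: F_def)
  have "K - (\<Union>w\<in>W. word_map S w ` K) \<subseteq> (\<Union>w\<in>W - F. cball (word_map S w x0) (C * ratio w))"
  proof
    fix x assume x: "x \<in> K - (\<Union>w\<in>W. word_map S w ` K)"
    obtain j where j: "set j \<subseteq> {1..m}" "x \<in> word_map S j ` K"
      "word_map S j ` K \<inter> (\<Union>w\<in>F. word_map S w ` K) = {}"
      using small_cylinder_avoiding[of x F] x F W by blast
    obtain u where u: "u \<in> W" "word_map S u ` K \<inter> word_map S j ` K \<noteq> {}" "c * ratio j \<le> ratio u"
      using large[OF j(1)] by blast
    have "u \<notin> F" using u(2) j(3) by blast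
    obtain a where a: "a \<in> K" "x = word_map S j a" using j(2) by auto
    obtain y where "y \<in> word_map S u ` K" "y \<in> word_map S j ` K" using u(2) by auto
    then obtain b d where bd: "b \<in> K" "d \<in> K" "word_map S u d = word_map S j b" by auto
    note abd = a bd
    have su: "set u \<subseteq> {1..m}" using subsetD[OF W u(1)] by (simp add: in_ifs_words)
    \<comment> \<open>The path to \<open>x\<close> passes through a common point of the two
      cylinders.\<close>
    have "dist (word_map S u x0) x \<le> dist (word_map S u x0) (word_map S u d) + dist (word_map S j b) x"
      using dist_triangle[of "word_map S u x0" x "word_map S u d"] abd by simp
    also have "\<dots> = ratio u * dist x0 d + ratio j * dist b a"
      using dist_word_map[OF su, of x0 d] dist_word_map[OF j(1), of b a] a(2) by simp
    also have "\<dots> \<le> ratio u * D + ratio u / c * D"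
    proof -
      have "ratio j \<le> ratio u / c" using u(3) \<open>0 < c\<close> by (simp add: field_simps)
      then show ?thesis
        using D abd x0 ratio_pos[OF su] ratio_pos[OF j(1)] \<open>0 < c\<close>
        by (intro add_mono mult_mono) auto
    qed
    also have "\<dots> = C * ratio u" by (simp add: C_def algebra_simps)
    finally show "x \<in> (\<Union>w\<in>W - F. cball (word_map S w x0) (C * ratio w))"
      using u \<open>u \<notin> F\<close> by auto
  qed
  moreover have "0 < C * ratio w \<and> 2 * (C * ratio w) \<le> \<eta>" if "w \<in> W - F" for w
  proof -
    have "0 < ratio w" using that W_pos by simp
    moreover have "ratio w < \<eta> / (2 * C)" using that by (auto simp: F_def)
    ultimately show ?thesis using \<open>0 < C\<close> by (simp add: field_simps)
  qed
  moreover have "(\<Sum>w\<in>G. (2 * (C * ratio w)) powr ?t) \<le> \<epsilon>" if "finite G" "G \<subseteq> W - F" for G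
  proof -
    have "0 \<le> ratio w" if "w \<in> G" for w
      using that \<open>G \<subseteq> W - F\<close> W_pos by (intro less_imp_le) auto
    then have "(\<Sum>w\<in>G. (2 * (C * ratio w)) powr ?t) = (\<Sum>w\<in>G. (2 * C) powr ?t * ratio w powr ?t)"
      using \<open>0 < C\<close> by (intro sum.cong refl) (simp add: powr_mult[symmetric] mult.assoc)
    also have "\<dots> = (2 * C) powr ?t * (\<Sum>w\<in>G. ratio w powr ?t)"
      by (simp add: sum_distrib_left)
    also have "\<dots> \<le> (2 * C) powr ?t * \<epsilon>'"
      using that by (intro mult_left_mono F1(3)) (auto simp: F_def)
    also have "\<dots> = \<epsilon>"
      using \<open>0 < C\<close> by (simp add: \<epsilon>'_def)
    finally show ?thesis .
  qed
  ultimately show "\<exists>(I :: nat list set) z b. K - (\<Union>w\<in>W. word_map S w ` K) \<subseteq> (\<Union>i\<in>I. cball (z i) (b i)) \<and>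
      (\<forall>i\<in>I. 0 < b i \<and> 2 * b i \<le> \<eta>) \<and>
      (\<forall>G. finite G \<longrightarrow> G \<subseteq> I \<longrightarrow> (\<Sum>i\<in>G. (2 * b i) powr ?t) \<le> \<epsilon>)"
    by (intro exI[of _ "W - F"] exI[of _ "\<lambda>w. word_map S w x0"] exI[of _ "\<lambda>w. C * ratio w"]) simp
qed

text \<open>The greedy selection is run on the words with orthogonal part near \<open>Q\<close>;
  uniform extension transfers its maximality to cylinders of arbitrary words.\<close>

lemma disjoint_cylinders_near_orthogonal_map:
  assumes Q: "Q \<in> closure (transformation_group m T)" and "0 < \<delta>"
  shows "\<exists>W \<subseteq> ifs_words m.
           (\<forall>i\<in>W. norm (word_orth T i - Q) < \<delta>) \<and>
           (\<forall>i\<in>W. \<forall>j\<in>W. i \<noteq> j \<longrightarrow> word_map S i ` K \<inter> word_map S j ` K = {}) \<and>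
           hausdorff_measure (hausdorff_dim K) (K - (\<Union>i\<in>W. word_map S i ` K)) = 0"
proof -
  define V where "V = {w\<in>ifs_words m. norm (word_orth T w - Q) < \<delta>}"
  define meets where "meets u w \<longleftrightarrow> word_map S u ` K \<inter> word_map S w ` K \<noteq> {}" for u w
  have "\<exists>W\<subseteq>V. (\<forall>u\<in>W. \<forall>w\<in>W. u \<noteq> w \<longrightarrow> \<not> meets u w) \<and>
    (\<forall>w\<in>V. \<exists>u\<in>W. (u = w \<or> meets u w) \<and> ratio w \<le> ratio u)"
  proof (rule greedy_subfamily)
    fix w assume "w \<in> V"
    then have "0 < ratio w" by (intro ratio_pos) (auto simp: V_def in_ifs_words)
    then show "finite {u\<in>V. ratio w \<le> ratio u}"
      by (rule finite_subset[OF _ finite_ratio_ge, rotated]) (auto simp: V_def in_ifs_words)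
  qed (auto simp: meets_def)
  then obtain W where W: "W \<subseteq> V" "\<And>u w. u \<in> W \<Longrightarrow> w \<in> W \<Longrightarrow> u \<noteq> w \<Longrightarrow> \<not> meets u w"
    "\<And>w. w \<in> V \<Longrightarrow> \<exists>u\<in>W. (u = w \<or> meets u w) \<and> ratio w \<le> ratio u"
    by metis
  obtain c where c: "0 < c"
    "\<And>j. set j \<subseteq> {1..m} \<Longrightarrow> \<exists>w\<in>ifs_words m. c \<le> ratio w \<and> norm (word_orth T (j @ w) - Q) < \<delta>"
    using uniform_word_extension[OF assms] by blast
  have "hausdorff_measure (hausdorff_dim K) (K - (\<Union>w\<in>W. word_map S w ` K)) = 0"
  proof (rule uncovered_part_null[OF _ _ c(1)])
    fix j assume j: "set j \<subseteq> {1..m}"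
    from c(2)[OF this] obtain w where w: "w \<in> ifs_words m" "c \<le> ratio w" "norm (word_orth T (j @ w) - Q) < \<delta>"
      by blast
    \<comment> \<open>An arbitrary \<open>j\<close> may lie outside \<open>V\<close>, but
      \<open>j @ w\<close> is in \<open>V\<close>, its cylinder lies in that of \<open>j\<close>,
      and its ratio is at least \<open>c * ratio j\<close>. So the word selected for
      \<open>j @ w\<close> also serves \<open>j\<close>.\<close>
    have "j @ w \<in> V" using w j by (auto simp: V_def in_ifs_words)
    from W(3)[OF this] obtain u where u: "u \<in> W" "u = j @ w \<or> meets u (j @ w)" "ratio (j @ w) \<le> ratio u"
      by blast
    have "word_map S (j @ w) ` K \<subseteq> word_map S j ` K"
      using word_map_in_K[of w] w by (auto simp: word_map_append in_ifs_words)
    then have "word_map S u ` K \<inter> word_map S j ` K \<noteq> {}"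
      using u(2) K_nonempty unfolding meets_def by blast
    moreover have "c * ratio j \<le> ratio w * ratio j"
      using w(2) ratio_pos[OF j] by simp
    then have "c * ratio j \<le> ratio u"
      using u(3) by (simp add: ratio_append mult.commute)
    ultimately show "\<exists>u\<in>W. word_map S u ` K \<inter> word_map S j ` K \<noteq> {} \<and> c * ratio j \<le> ratio u"
      using u(1) by blast
  qed (use W in \<open>auto simp: V_def meets_def\<close>)
  with W show ?thesis
    by (intro exI[of _ W]) (auto simp: V_def meets_def)
qed

end

theorem proposition1p9:
  fixes m :: nat
    and S :: "nat \<Rightarrow> real ^ 'd \<Rightarrow> real ^ 'd"
    and r :: "nat \<Rightarrow> real"
    and T :: "nat \<Rightarrow> (real ^ 'd) \<Rightarrow>\<^sub>L (real ^ 'd)"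
    and v :: "nat \<Rightarrow> real ^ 'd"
    and K :: "(real ^ 'd) set"
    and Q :: "(real ^ 'd) \<Rightarrow>\<^sub>L (real ^ 'd)"
    and t \<delta> :: real
  assumes "ss_ifs m S r T v"
    and "is_attractor m S K"
    and "\<exists>x\<in>K. \<exists>y\<in>K. x \<noteq> y"
    and "t = hausdorff_dim K"
    and "Q \<in> closure (transformation_group m T)"
    and "\<delta> > 0"
  shows "\<exists>W \<subseteq> ifs_words m.
           (\<forall>i\<in>W. norm (word_orth T i - Q) < \<delta>) \<and>
           (\<forall>i\<in>W. \<forall>j\<in>W. i \<noteq> j \<longrightarrow> word_map S i ` K \<inter> word_map S j ` K = {}) \<and>
           hausdorff_measure t (K - (\<Union>i\<in>W. word_map S i ` K)) = 0"
proof -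
  interpret self_similar_set m S r T v K
    using assms by unfold_locales
  show ?thesis
    using disjoint_cylinders_near_orthogonal_map[OF assms(5,6)] by (simp add: assms(4))
qed

end
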